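(* For any integer $k\geq 1$, if $\varepsilon=c/k^2$ with $0<c<1$, then $G_2(\varepsilon,2^k+1)>\frac{c}{24}\varepsilon$.
   Context: A Steiner topology for $n$ terminals is a (graph-theoretic) tree $\mathcal{T}$ with $n$ special vertices $t_1,\dots,t_n$, called terminals, all of degree at most $3$, and all other vertices, called Steiner points, of degree exactly $3$. It is full if all terminals have degree $1$. Given a family $p_1,\dots,p_n$ of points in $\mathbb{R}^d$ (repetitions allowed), a Steiner tree with topology $\mathcal{T}$ on these points is a representation of $\mathcal{T}$ in $\mathbb{R}^d$ in which $t_i$ is represented by $p_i$, each Steiner point by an arbitrary point of $\mathbb{R}^d$, and each edge by a straight-line segment; points may coincide (so edges may have length $0$; such edges, and trees containing them, are called degenerate) and edges may cross. The length $L(T)$ is the sum of the Euclidean lengths of the edges. Angles are measured in $[0,\pi]$. For $\varepsilon\geq 0$, an $\varepsilon$-approximate Steiner tree is a tree with a Steiner topology such that at each Steiner point all three angles spanned by pairs of incident edges belong to $[2\pi/3-\varepsilon,2\pi/3+\varepsilon]$ (in particular these angles are defined, so edges at Steiner points have positive length). $\mathcal{A}_\varepsilon^d(n)$ denotes the set of all $\varepsilon$-approximate Steiner trees in $\mathbb{R}^d$ with full Steiner topology on $n$ terminals; thus $\mathcal{A}_0^d(n)$ is the set of all full locally minimum Steiner trees on $n$ terminals in $\mathbb{R}^d$ (non-degenerate, all angles at Steiner points equal to $2\pi/3$). For a tree $T$ in $\mathbb{R}^d$ with Steiner topology $\mathcal{T}$, $S(T)$ denotes the (unique) shortest tree in $\mathbb{R}^d$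 on the terminals of $T$ with topology $\mathcal{T}$, where degenerate trees are allowed. Define \[G_d(\varepsilon,n)=\sup\left\{\frac{L(T)-L(S(T))}{L(S(T))}: T\in\mathcal{A}_\varepsilon^d(n),\ S(T)\in\mathcal{A}_0^d(n)\right\}.\] *)

theory Defs
  imports "HOL-Analysis.Analysis"
begin

section \<open>Trees\<close>

text \<open>Graphs are finite, undirected and simple; an edge is the two-element set of its ends.\<close>

definition simple_graph :: "'v set \<Rightarrow> 'v set set \<Rightarrow> bool" where
  "simple_graph V E \<longleftrightarrow> finite V \<and> (\<forall>e\<in>E. e \<subseteq> V \<and> card e = 2)"

definition connected_graph :: "'v set \<Rightarrow> 'v set set \<Rightarrow> bool" where
  "connected_graph V E \<longleftrightarrow> V \<noteq> {} \<and> (\<forall>u\<in>V. \<forall>v\<in>V. (u, v) \<in> {(a, b). {a, b} \<in> E}\<^sup>*)"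

text \<open>A cycle is given by the list of its (at least three, pairwise distinct) vertices.\<close>

definition is_cycle :: "'v set set \<Rightarrow> 'v list \<Rightarrow> bool" where
  "is_cycle E vs \<longleftrightarrow> 3 \<le> length vs \<and> distinct vs \<and>
     (\<forall>i<length vs. {vs ! i, vs ! (Suc i mod length vs)} \<in> E)"

definition is_tree :: "'v set \<Rightarrow> 'v set set \<Rightarrow> bool" where
  "is_tree V E \<longleftrightarrow> simple_graph V E \<and> connected_graph V E \<and> (\<nexists>vs. is_cycle E vs)"

definition degree :: "'v set set \<Rightarrow> 'v \<Rightarrow> nat" where
  "degree E v = card {e \<in> E. v \<in> e}"


section \<open>Steiner topologies and their representations\<close>

text \<open>
  The terminals are \<open>terminal 1, \<dots>, terminal n\<close>; values at other indices are irrelevant.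
  Vertices are natural numbers: every finite graph is isomorphic to one of these.
\<close>

record topology =
  verts :: "nat set"
  edges :: "nat set set"
  terminal :: "nat \<Rightarrow> nat"

definition steiner_points :: "nat \<Rightarrow> topology \<Rightarrow> nat set" where
  "steiner_points n \<T> = verts \<T> - terminal \<T> ` {1..n}"

definition steiner_topology :: "nat \<Rightarrow> topology \<Rightarrow> bool" where
  "steiner_topology n \<T> \<longleftrightarrow>
     is_tree (verts \<T>) (edges \<T>) \<and>
     inj_on (terminal \<T>) {1..n} \<and> terminal \<T> ` {1..n} \<subseteq> verts \<T> \<and>
     (\<forall>i\<in>{1..n}. degree (edges \<T>) (terminal \<T> i) \<le> 3) \<and>
     (\<forall>s\<in>steiner_points n \<T>. degree (edges \<T>) s = 3)"

definition full_topology :: "nat \<Rightarrow> topology \<Rightarrow> bool" where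
  "full_topology n \<T> \<longleftrightarrow>
     steiner_topology n \<T> \<and> (\<forall>i\<in>{1..n}. degree (edges \<T>) (terminal \<T> i) = 1)"

text \<open>
  A tree in \<open>'a\<close> is a topology together with a position for every vertex
  (positions of numbers that are not vertices are irrelevant). Positions may coincide.
\<close>

type_synonym 'a steiner_tree = "topology \<times> (nat \<Rightarrow> 'a)"

text \<open>Every edge occurs in the sum with both of its orientations, hence the division by 2.\<close>

definition tree_length :: "'a::euclidean_space steiner_tree \<Rightarrow> real" where
  "tree_length = (\<lambda>(\<T>, x). (\<Sum>(u, v) | {u, v} \<in> edges \<T>. dist (x u) (x v)) / 2)"

definition angle :: "'a::euclidean_space \<Rightarrow> 'a \<Rightarrow> real" where
  "angle a b = arccos (a \<bullet> b / (norm a * norm b))"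

text \<open>
  The set of \<open>\<epsilon>\<close>-approximate Steiner trees with full topology on \<open>n\<close> terminals. Angles with a
  zero vector are undefined, so edges at Steiner points are required to have positive length.
\<close>

definition approx_trees :: "real \<Rightarrow> nat \<Rightarrow> 'a::euclidean_space steiner_tree set" where
  "approx_trees \<epsilon> n = {(\<T>, x). full_topology n \<T> \<and>
     (\<forall>s\<in>steiner_points n \<T>.
        (\<forall>u. {s, u} \<in> edges \<T> \<longrightarrow> x u \<noteq> x s) \<and>
        (\<forall>u v. {s, u} \<in> edges \<T> \<and> {s, v} \<in> edges \<T> \<and> u \<noteq> v \<longrightarrow>
           angle (x u - x s) (x v - x s) \<in> {2 * pi / 3 - \<epsilon> .. 2 * pi / 3 + \<epsilon>}))}"

text \<open>
  \<open>is_shortest n T S\<close>: \<open>S\<close> is a shortest tree with the terminals and the topology of \<open>T\<close>,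
  degenerate trees being allowed as competitors. It is used as a relation because for
  special positions of the terminals there are several shortest trees; a shortest tree
  in \<open>approx_trees 0 n\<close> is the only one.
\<close>

definition is_shortest ::
    "nat \<Rightarrow> 'a::euclidean_space steiner_tree \<Rightarrow> 'a steiner_tree \<Rightarrow> bool" where
  "is_shortest n T S \<longleftrightarrow>
     (let (\<T>, p) = T;
          same_terminals = (\<lambda>y. \<forall>i\<in>{1..n}. y (terminal \<T> i) = p (terminal \<T> i))
      in fst S = \<T> \<and> same_terminals (snd S) \<and>
         (\<forall>y. same_terminals y \<longrightarrow> tree_length S \<le> tree_length (\<T>, y)))"

text \<open>
  The dimension \<open>d\<close> is that of the type \<open>'a\<close>. The supremum is taken in the extended reals
  since boundedness is not known in advance.
\<close>

definition steiner_gap :: "'a::euclidean_space itself \<Rightarrow> real \<Rightarrow> nat \<Rightarrow> ereal" where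
  "steiner_gap _ \<epsilon> n = Sup {ereal ((tree_length T - tree_length S) / tree_length S) | T S.
     (T :: 'a steiner_tree) \<in> approx_trees \<epsilon> n \<and> is_shortest n T S \<and> S \<in> approx_trees 0 n}"

end

theory Submission
  imports Defs "HOL-Library.Discrete_Functions"
begin

text \<open>
  The supremum is bounded below by a single pair of trees on the complete binary topology: a root
  terminal, joined to a root Steiner point, below which every Steiner point has two children, down
  to the \<open>2 ^ k\<close> leaves, which are the other terminals. The edges fall into levels \<open>0, \<dots>, k\<close>.

  In the straight tree the direction turns by exactly \<open>\<plusminus>\<pi>/3\<close> from each edge to the edges below it. In
  the tilted tree it turns by \<open>\<plusminus>\<pi>/3 + \<epsilon>\<close>, so that angles at Steiner points are off by at most
  \<open>\<epsilon>\<close>, but the errors accumulate: starting from a root edge tilted by \<open>- k\<epsilon>/2\<close>, the edges at level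
  \<open>j\<close> are tilted by \<open>\<phi>\<^sub>j = (2j - k)\<epsilon>/2\<close> against those of the straight tree. All edges of the tilted
  tree at level \<open>j\<close> have length \<open>2\<^sup>-\<^sup>j\<close>, so every level contributes \<open>1\<close> to its length.

  Length of the straight tree. Its unit edge directions balance at every Steiner point, so for every
  tree with this topology the sum of the inner products of its edge vectors with these directions
  depends on the terminals only (\<open>sum_balanced_directions\<close>). By Cauchy-Schwarz this sum is a lower
  bound for the length, attained by the straight tree (\<open>binary_calibration\<close>). Hence, if the two trees
  have the same terminals, the straight tree is shortest, and evaluating the sum on the tilted tree
  shows that its length is \<open>\<Sum>\<^sub>j cos \<phi>\<^sub>j = sin ((k + 1)\<epsilon>/2) / sin (\<epsilon>/2)\<close>, while the tilted tree has
  length \<open>k + 1\<close>. Taylor bounds for the sine then give a relative gain of more than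
  \<open>k\<^sup>2\<epsilon>\<^sup>2/24 = c\<epsilon>/24\<close> (\<open>sin_ratio_bound\<close>).

  Common terminals. The straight tree is obtained by moving each Steiner point of the tilted tree at
  right angles to the straight direction of the edge above it, by an amount \<open>2\<^sup>-\<^sup>j \<sigma>\<^sub>j\<^sub>+\<^sub>1\<close> at level
  \<open>j\<close>. Edges get the straight directions provided that \<open>\<sigma>\<^sub>j - \<sigma>\<^sub>j\<^sub>+\<^sub>1 = sin \<phi>\<^sub>j\<close> and \<open>\<sigma>\<^sub>0 = 0\<close>. Since
  \<open>\<phi>\<^sub>j = - \<phi>\<^sub>k\<^sub>-\<^sub>j\<close>, the sines sum to \<open>0\<close>, so \<open>\<sigma>\<^sub>k\<^sub>+\<^sub>1 = 0\<close> and the leaves do not move. The resulting edges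
  have length \<open>2\<^sup>-\<^sup>j (cos \<phi>\<^sub>j \<plusminus> \<surd>3 \<sigma>\<^sub>j)\<close> (\<open>straight_tree_edge\<close>). These must be positive, and this is
  where \<open>\<epsilon> = c/k\<^sup>2\<close> with \<open>c < 1\<close> enters: \<open>\<sigma>\<close> is of order \<open>k\<^sup>2\<epsilon>\<close> (\<open>abs_shift_le\<close>).

  The trees are constructed in the complex plane, which is isometric to \<open>\<real>\<^sup>2\<close>.
\<close>

section \<open>Linear isometries\<close>

lemma steiner_gap_isometry:
  fixes f :: "'a::euclidean_space \<Rightarrow> 'b::euclidean_space"
  assumes lin: "linear f" and inner: "\<And>a b. f a \<bullet> f b = a \<bullet> b" and surj: "surj f"
  shows "steiner_gap TYPE('a) \<epsilon> n \<le> steiner_gap TYPE('b) \<epsilon> n"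
proof -
  have norm: "norm (f a) = norm a" for a
    by (simp add: norm_eq_sqrt_inner inner)
  have diff: "f a - f b = f (a - b)" for a b
    using lin by (simp add: linear_diff)
  have dist: "dist (f a) (f b) = dist a b" for a b
    by (simp add: dist_norm diff norm)
  have angle: "angle (f a) (f b) = angle a b" for a b
    by (simp add: angle_def inner norm)
  have eq_iff: "f a = f b \<longleftrightarrow> a = b" for a b
    using dist[of a b] by (metis dist_eq_0_iff)
  have len: "tree_length (\<T>, f \<circ> x) = tree_length (\<T>, x)" for \<T> x
    by (simp add: tree_length_def dist)
  have approx: "(\<T>, f \<circ> x) \<in> approx_trees \<delta> n" if "(\<T>, x) \<in> approx_trees \<delta> n" for \<T> x \<delta>
    using that by (simp add: approx_trees_def diff angle eq_iff)
  have shortest: "is_shortest n (\<T>, f \<circ> x) (\<T>, f \<circ> z)" if "is_shortest n (\<T>, x) (\<T>, z)" for \<T> x z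
  proof -
    have le: "tree_length (\<T>, f \<circ> z) \<le> tree_length (\<T>, y)"
      if y: "\<forall>i\<in>{1..n}. y (terminal \<T> i) = f (x (terminal \<T> i))" for y
    proof -
      define y' where "y' = inv f \<circ> y"
      have "y = f \<circ> y'"
        using surj by (auto simp: y'_def surj_f_inv_f)
      moreover from this have "\<forall>i\<in>{1..n}. y' (terminal \<T> i) = x (terminal \<T> i)"
        using y by (simp add: eq_iff)
      ultimately show ?thesis
        using \<open>is_shortest n (\<T>, x) (\<T>, z)\<close> by (simp add: is_shortest_def len)
    qed
    show ?thesis
      using that le by (simp add: is_shortest_def)
  qed
  show ?thesis
    unfolding steiner_gap_def
  proof (rule Sup_mono, safe)
    fix \<T> \<T>' and x z :: "nat \<Rightarrow> 'a"
    assume *: "(\<T>, x) \<in> approx_trees \<epsilon> n" "is_shortest n (\<T>, x) (\<T>', z)" "(\<T>', z) \<in> approx_trees 0 n"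
    then have [simp]: "\<T>' = \<T>"
      by (simp add: is_shortest_def)
    have "(\<T>, f \<circ> x) \<in> approx_trees \<epsilon> n \<and> is_shortest n (\<T>, f \<circ> x) (\<T>, f \<circ> z) \<and>
        (\<T>, f \<circ> z) \<in> approx_trees 0 n"
      using * approx shortest by simp
    then have "ereal ((tree_length (\<T>, f \<circ> x) - tree_length (\<T>, f \<circ> z)) / tree_length (\<T>, f \<circ> z))
        \<in> {ereal ((tree_length T - tree_length S) / tree_length S) |T S.
          (T :: 'b steiner_tree) \<in> approx_trees \<epsilon> n \<and> is_shortest n T S \<and> S \<in> approx_trees 0 n}"
      by blast
    then show "\<exists>b\<in>{ereal ((tree_length T - tree_length S) / tree_length S) |T S.
          (T :: 'b steiner_tree) \<in> approx_trees \<epsilon> n \<and> is_shortest n T S \<and> S \<in> approx_trees 0 n}.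
        ereal ((tree_length (\<T>, x) - tree_length (\<T>', z)) / tree_length (\<T>', z)) \<le> b"
      by (rule bexI[rotated]) (simp add: len)
  qed
qed

lemma steiner_gap_complex_le: "steiner_gap TYPE(complex) \<epsilon> n \<le> steiner_gap TYPE(real ^ 2) \<epsilon> n"
proof (rule steiner_gap_isometry)
  let ?f = "\<lambda>z. (\<chi> i. if i = 1 then Re z else Im z) :: real ^ 2"
  show "linear ?f"
    by (rule linearI) (auto simp: vec_eq_iff)
  show "?f a \<bullet> ?f b = a \<bullet> b" for a b
    by (simp add: inner_vec_def sum_2 inner_complex_def)
  show "surj ?f"
  proof (rule surjI)
    fix y :: "real ^ 2"
    show "?f (Complex (y $ 1) (y $ 2)) = y"
      by (simp add: vec_eq_iff forall_2)
  qed
qed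


section \<open>The complete binary topology\<close>

text \<open>
  Vertices are numbered as in a binary heap: the parent of \<open>v \<ge> 1\<close> is \<open>v div 2\<close>. Thus \<open>0\<close> is the root
  terminal, whose only child is \<open>1\<close>; every \<open>v\<close> with \<open>1 \<le> v < 2 ^ k\<close> is a Steiner point with children
  \<open>2 * v\<close> and \<open>2 * v + 1\<close>; and \<open>2 ^ k, \<dots>, 2 * 2 ^ k - 1\<close> are the leaves. The edge from \<open>v\<close> to its
  parent has level \<open>floor_log v\<close>.
\<close>

definition binary_topology :: "nat \<Rightarrow> topology" where
  "binary_topology k =
     \<lparr>verts = {..<2 * 2 ^ k}, edges = (\<lambda>v. {v, v div 2}) ` {1..<2 * 2 ^ k},
      terminal = (\<lambda>i. if i = 1 then 0 else 2 ^ k + i - 2)\<rparr>"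

lemma binary_edge_iff:
  "{a, b} \<in> edges (binary_topology k) \<longleftrightarrow>
     (a = b div 2 \<and> 1 \<le> b \<and> b < 2 * 2 ^ k) \<or> (b = a div 2 \<and> 1 \<le> a \<and> a < 2 * 2 ^ k)"
  by (auto simp: binary_topology_def doubleton_eq_iff)

lemma binary_terminals: "terminal (binary_topology k) ` {1..2 ^ k + 1} = insert 0 {2 ^ k..<2 * 2 ^ k}"
proof -
  have "v \<in> terminal (binary_topology k) ` {1..2 ^ k + 1}" if "v \<in> {2 ^ k..<2 * 2 ^ k}" for v
    using that by (intro image_eqI[of _ _ "v + 2 - 2 ^ k"]) (auto simp: binary_topology_def)
  moreover have "0 \<in> terminal (binary_topology k) ` {1..2 ^ k + 1}"
    by (intro image_eqI[of _ _ 1]) (auto simp: binary_topology_def)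
  moreover have "terminal (binary_topology k) ` {1..2 ^ k + 1} \<subseteq> insert 0 {2 ^ k..<2 * 2 ^ k}"
    by (auto simp: binary_topology_def)
  ultimately show ?thesis
    by blast
qed

lemma binary_steiner_points: "steiner_points (2 ^ k + 1) (binary_topology k) = {1..<2 ^ k}"
  unfolding steiner_points_def binary_terminals by (auto simp: binary_topology_def)

lemma binary_incident_edges:
  "{e \<in> edges (binary_topology k). v \<in> e} =
     (if 1 \<le> v \<and> v < 2 * 2 ^ k then {{v, v div 2}} else {}) \<union>
     (\<lambda>w. {w, v}) ` {w. w div 2 = v \<and> 1 \<le> w \<and> w < 2 * 2 ^ k}"
  by (auto simp: binary_topology_def)

lemma binary_degree_terminal:
  assumes "k \<ge> 1" and "v \<in> insert 0 {2 ^ k..<2 * 2 ^ k}"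
  shows "degree (edges (binary_topology k)) v = 1"
proof -
  have 2: "(2::nat) \<le> 2 ^ k"
    using assms(1) by (metis power_increasing power_one_right one_le_numeral)
  consider "v = 0" | "2 ^ k \<le> v" "v < 2 * 2 ^ k"
    using assms(2) by auto
  then show ?thesis
  proof cases
    case 1
    have "{w. w div 2 = v \<and> 1 \<le> w \<and> w < 2 * 2 ^ k} = {1}"
      using 1 2 by auto
    then show ?thesis
      using 1 unfolding degree_def binary_incident_edges by simp
  next
    case 2
    then have no_child: "{w. w div 2 = v \<and> 1 \<le> w \<and> w < 2 * 2 ^ k} = {}" and "1 \<le> v"
      using \<open>2 \<le> 2 ^ k\<close> by auto
    then show ?thesis
      using 2 unfolding degree_def binary_incident_edges no_child by simp
  qed
qed

lemma binary_degree_steiner_point: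
  assumes "v \<in> {1..<2 ^ k}"
  shows "degree (edges (binary_topology k)) v = 3"
proof -
  have "{w. w div 2 = v \<and> 1 \<le> w \<and> w < 2 * 2 ^ k} = {2 * v, 2 * v + 1}"
    using assms by auto
  then have *: "{e \<in> edges (binary_topology k). v \<in> e} = {{v, v div 2}, {2 * v, v}, {2 * v + 1, v}}"
    using assms unfolding binary_incident_edges by auto
  have "v div 2 < v"
    using assms by auto
  then show ?thesis
    unfolding degree_def * using assms by (simp add: doubleton_eq_iff)
qed

lemma binary_is_tree: "is_tree (verts (binary_topology k)) (edges (binary_topology k))"
proof -
  let ?V = "verts (binary_topology k)" and ?E = "edges (binary_topology k)"
  let ?r = "{(a, b). {a, b} \<in> ?E}"
  have "simple_graph ?V ?E"
    by (auto simp: simple_graph_def binary_topology_def)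
  moreover have "connected_graph ?V ?E"
  proof -
    have root: "(v, 0) \<in> ?r\<^sup>*" if "v < 2 * 2 ^ k" for v
      using that
    proof (induction v rule: less_induct)
      case (less v)
      show ?case
      proof (cases "v = 0")
        case False
        then have "(v, v div 2) \<in> ?r"
          using less.prems by (simp add: binary_edge_iff)
        moreover have "(v div 2, 0) \<in> ?r\<^sup>*"
          using less False by simp
        ultimately show ?thesis
          by (rule converse_rtrancl_into_rtrancl)
      qed simp
    qed
    have "sym (?r\<^sup>*)"
      by (intro sym_rtrancl) (auto simp: sym_def insert_commute)
    then have "(u, v) \<in> ?r\<^sup>*" if "u \<in> ?V" "v \<in> ?V" for u v
      using root[of u] root[of v] that
      by (metis (no_types, lifting) binary_topology_def lessThan_iff rtrancl_trans symD topology.select_convs(1))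
    moreover have "0 \<in> ?V"
      by (simp add: binary_topology_def)
    ultimately show ?thesis
      unfolding connected_graph_def by blast
  qed
  moreover have "\<not> is_cycle ?E vs" for vs
  proof
    assume "is_cycle ?E vs"
    then have len: "3 \<le> length vs" and "distinct vs"
      and edge: "\<And>i. i < length vs \<Longrightarrow> {vs ! i, vs ! (Suc i mod length vs)} \<in> ?E"
      by (auto simp: is_cycle_def)
    let ?n = "length vs"
    have "Max (set vs) \<in> set vs"
      using len by (intro Max_in) auto
    then obtain i where i: "i < ?n" "vs ! i = Max (set vs)"
      by (metis in_set_conv_nth)
    define p s where "p = (if i = 0 then ?n - 1 else i - 1)" and "s = Suc i mod ?n"
    have ps: "p < ?n" "s < ?n" "p \<noteq> i" "s \<noteq> i" "p \<noteq> s" "Suc p mod ?n = i"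
      using i len by (auto simp: p_def s_def mod_Suc)
    \<comment> \<open>a neighbour of the largest vertex is smaller, hence it is its parent\<close>
    have parent: "vs ! j = vs ! i div 2" if "j < ?n" "j \<noteq> i" "{vs ! i, vs ! j} \<in> ?E" for j
    proof -
      have "vs ! j \<noteq> vs ! i"
        using nth_eq_iff_index_eq[OF \<open>distinct vs\<close>, of j i] that i(1) by blast
      moreover have "vs ! j \<le> vs ! i"
        using that i by simp
      ultimately show ?thesis
        using that(3) unfolding binary_edge_iff by auto
    qed
    have "vs ! s = vs ! i div 2"
      using parent[of s] edge[of i] i ps by (simp add: s_def)
    moreover have "vs ! p = vs ! i div 2"
      using parent[of p] edge[of p] i ps by (simp add: insert_commute)
    ultimately have "p = s"
      using \<open>distinct vs\<close> ps by (metis nth_eq_iff_index_eq)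
    with ps show False
      by simp
  qed
  ultimately show ?thesis
    unfolding is_tree_def by blast
qed

lemma binary_full_topology:
  assumes "k \<ge> 1"
  shows "full_topology (2 ^ k + 1) (binary_topology k)"
proof -
  have deg: "degree (edges (binary_topology k)) (terminal (binary_topology k) i) = 1"
    if "i \<in> {1..2 ^ k + 1}" for i
    using binary_degree_terminal[OF assms] binary_terminals[of k] that by blast
  moreover have "inj_on (terminal (binary_topology k)) {1..2 ^ k + 1}"
  proof -
    have "card (terminal (binary_topology k) ` {1..2 ^ k + 1}) = card {1..(2::nat) ^ k + 1}"
      unfolding binary_terminals by simp
    then show ?thesis
      by (intro eq_card_imp_inj_on) auto
  qed
  moreover have "terminal (binary_topology k) ` {1..2 ^ k + 1} \<subseteq> verts (binary_topology k)"
    unfolding binary_terminals by (auto simp: binary_topology_def)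
  ultimately show ?thesis
    unfolding full_topology_def steiner_topology_def binary_steiner_points
    using binary_is_tree binary_degree_steiner_point by auto
qed

lemma binary_tree_length:
  "tree_length (binary_topology k, x) = (\<Sum>v = 1..<2 * 2 ^ k. dist (x v) (x (v div 2)))"
proof -
  let ?I = "{1..<2 * 2 ^ k} :: nat set"
  let ?up = "\<lambda>v::nat. (v, v div 2)" and ?down = "\<lambda>v::nat. (v div 2, v)"
  let ?d = "\<lambda>(u, v). dist (x u) (x v)"
  have "{(u, v). {u, v} \<in> edges (binary_topology k)} = ?up ` ?I \<union> ?down ` ?I"
    unfolding binary_edge_iff by auto
  moreover have "?up ` ?I \<inter> ?down ` ?I = {}"
  proof -
    have False if "u = v div 2" "v = u div 2" "1 \<le> u" for u v :: nat
      using that by auto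
    then show ?thesis
      by auto
  qed
  moreover have "sum ?d (?up ` ?I) = (\<Sum>v\<in>?I. dist (x v) (x (v div 2)))"
    by (subst sum.reindex) (auto simp: inj_on_def)
  moreover have "sum ?d (?down ` ?I) = (\<Sum>v\<in>?I. dist (x v) (x (v div 2)))"
    by (subst sum.reindex) (auto simp: inj_on_def dist_commute)
  ultimately have "sum ?d {(u, v). {u, v} \<in> edges (binary_topology k)} =
      2 * (\<Sum>v\<in>?I. dist (x v) (x (v div 2)))"
    by (simp add: sum.union_disjoint)
  then show ?thesis
    by (simp add: tree_length_def)
qed

lemma sum_siblings:
  fixes f :: "nat \<Rightarrow> 'b::comm_monoid_add"
  assumes "1 \<le> m"
  shows "(\<Sum>v = 1..<2 * m. f v) = f 1 + (\<Sum>p = 1..<m. f (2 * p) + f (2 * p + 1))"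
  using assms
proof (induction m rule: nat_induct_at_least)
  case (Suc m)
  have "{1..<2 * Suc m} = insert (2 * m) (insert (2 * m + 1) {1..<2 * m})"
    using Suc.hyps by auto
  then have "(\<Sum>v = 1..<2 * Suc m. f v) = (\<Sum>v = 1..<2 * m. f v) + (f (2 * m) + f (2 * m + 1))"
    by (simp add: ac_simps)
  then show ?case
    using Suc by (simp add: ac_simps)
qed (simp add: numeral_2_eq_2)

text \<open>
  If the unit directions of the edges balance at each Steiner point, then the Steiner points cancel
  from the sum below, which is therefore determined by the positions of the terminals.
\<close>

lemma sum_balanced_directions:
  fixes y U :: "nat \<Rightarrow> 'a::real_inner"
  assumes "\<And>p. 1 \<le> p \<Longrightarrow> U (2 * p) + U (2 * p + 1) = U p" and "1 \<le> m"
  shows "(\<Sum>v = 1..<2 * m. (y v - y (v div 2)) \<bullet> U v) = (\<Sum>v = m..<2 * m. y v \<bullet> U v) - y 0 \<bullet> U 1"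
proof -
  have "(\<Sum>v = 1..<2 * m. y (v div 2) \<bullet> U v) =
      y 0 \<bullet> U 1 + (\<Sum>p = 1..<m. y p \<bullet> U (2 * p) + y p \<bullet> U (2 * p + 1))"
    by (subst sum_siblings[OF assms(2)]) simp
  also have "(\<Sum>p = 1..<m. y p \<bullet> U (2 * p) + y p \<bullet> U (2 * p + 1)) = (\<Sum>p = 1..<m. y p \<bullet> U p)"
    by (intro sum.cong refl) (simp only: assms(1) atLeastLessThan_iff flip: inner_add_right)
  finally have "(\<Sum>v = 1..<2 * m. y (v div 2) \<bullet> U v) = y 0 \<bullet> U 1 + (\<Sum>p = 1..<m. y p \<bullet> U p)" .
  moreover have "(\<Sum>v = 1..<2 * m. y v \<bullet> U v) = (\<Sum>p = 1..<m. y p \<bullet> U p) + (\<Sum>v = m..<2 * m. y v \<bullet> U v)"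
    using assms(2) by (simp add: sum.atLeastLessThan_concat)
  ultimately show ?thesis
    by (simp add: inner_diff_left sum_subtractf)
qed

text \<open>
  A tree whose edges have balanced directions is shortest, and its length can be computed from any
  other tree \<open>x\<close> with the same terminals.
\<close>

lemma binary_calibration:
  fixes x U :: "nat \<Rightarrow> 'a::euclidean_space"
  assumes bal: "\<And>p. 1 \<le> p \<Longrightarrow> U (2 * p) + U (2 * p + 1) = U p"
    and unit: "\<And>v. norm (U v) = 1"
    and dir: "\<And>v. v \<in> {1..<2 * 2 ^ k} \<Longrightarrow> \<exists>l\<ge>0. z v - z (v div 2) = l *\<^sub>R U v"
    and ends: "\<And>v. v \<in> insert 0 {2 ^ k..<2 * 2 ^ k} \<Longrightarrow> z v = x v"
  shows "tree_length (binary_topology k, z) = (\<Sum>v = 1..<2 * 2 ^ k. (x v - x (v div 2)) \<bullet> U v)"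
    and "is_shortest (2 ^ k + 1) (binary_topology k, x) (binary_topology k, z)"
proof -
  have eq: "tree_length (binary_topology k, z) = (\<Sum>v = 1..<2 * 2 ^ k. (y v - y (v div 2)) \<bullet> U v)"
    if y: "\<And>v. v \<in> insert 0 {2 ^ k..<2 * 2 ^ k} \<Longrightarrow> y v = x v" for y
  proof -
    have "dist (z v) (z (v div 2)) = (z v - z (v div 2)) \<bullet> U v" if v: "v \<in> {1..<2 * 2 ^ k}" for v
    proof -
      obtain l where "l \<ge> 0" "z v - z (v div 2) = l *\<^sub>R U v"
        using dir[OF v] by blast
      moreover have "U v \<bullet> U v = 1"
        using unit[of v] by (simp add: dot_square_norm)
      ultimately show ?thesis
        by (simp add: dist_norm unit)
    qed
    then have "tree_length (binary_topology k, z) = (\<Sum>v = 1..<2 * 2 ^ k. (z v - z (v div 2)) \<bullet> U v)"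
      unfolding binary_tree_length by (intro sum.cong) auto
    also have "\<dots> = (\<Sum>v = 1..<2 * 2 ^ k. (y v - y (v div 2)) \<bullet> U v)"
      using sum_balanced_directions[OF bal, of "2 ^ k"] by (simp add: y ends)
    finally show ?thesis .
  qed
  show "tree_length (binary_topology k, z) = (\<Sum>v = 1..<2 * 2 ^ k. (x v - x (v div 2)) \<bullet> U v)"
    by (rule eq) simp
  have "tree_length (binary_topology k, z) \<le> tree_length (binary_topology k, y)"
    if y: "\<And>v. v \<in> insert 0 {2 ^ k..<2 * 2 ^ k} \<Longrightarrow> y v = x v" for y
  proof -
    have "(y v - y (v div 2)) \<bullet> U v \<le> dist (y v) (y (v div 2))" for v
      using norm_cauchy_schwarz[of "y v - y (v div 2)" "U v"] by (simp add: unit dist_norm)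
    then have "(\<Sum>v = 1..<2 * 2 ^ k. (y v - y (v div 2)) \<bullet> U v) \<le> tree_length (binary_topology k, y)"
      unfolding binary_tree_length by (intro sum_mono) auto
    then show ?thesis
      using eq[of y] y by simp
  qed
  moreover have "(\<forall>i\<in>{1..2 ^ k + 1}. y (terminal (binary_topology k) i) = w (terminal (binary_topology k) i))
      \<longleftrightarrow> (\<forall>v\<in>insert 0 {2 ^ k..<2 * 2 ^ k}. y v = w v)" for y w :: "nat \<Rightarrow> 'a"
    unfolding binary_terminals[symmetric] by simp
  ultimately show "is_shortest (2 ^ k + 1) (binary_topology k, x) (binary_topology k, z)"
    unfolding is_shortest_def Let_def using ends by (simp only: prod.case fst_conv snd_conv) blast
qed


section \<open>Angles in the complete binary topology\<close>

lemma angle_commute: "angle a b = angle b a"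
  by (simp add: angle_def inner_commute mult.commute)

lemma angle_cis:
  assumes "r > 0" and "s > 0" and "norm w = 1" and "0 \<le> \<eta> - \<zeta>" and "\<eta> - \<zeta> \<le> pi"
  shows "angle (of_real r * (w * cis \<zeta>)) (of_real s * (w * cis \<eta>)) = \<eta> - \<zeta>"
proof -
  have w: "(Re w)\<^sup>2 + (Im w)\<^sup>2 = 1"
    using assms(3) by (simp add: norm_complex_def)
  have "(w * cis \<zeta>) \<bullet> (w * cis \<eta>) = ((Re w)\<^sup>2 + (Im w)\<^sup>2) * cos (\<eta> - \<zeta>)"
    by (simp add: inner_complex_def cos_diff power2_eq_square algebra_simps)
  then have "(w * cis \<zeta>) \<bullet> (w * cis \<eta>) = cos (\<eta> - \<zeta>)"
    by (simp add: w)
  then have "(of_real r * (w * cis \<zeta>)) \<bullet> (of_real s * (w * cis \<eta>)) = r * s * cos (\<eta> - \<zeta>)"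
    by (simp flip: scaleR_conv_of_real)
  then show ?thesis
    using assms by (simp add: angle_def norm_mult arccos_cos)
qed

text \<open>
  The unit vector \<open>W v\<close> is the direction of the edge from the parent of \<open>v\<close> to \<open>v\<close>. If it turns by
  \<open>\<pi>/3 + \<delta>\<close> towards one child and by \<open>- \<pi>/3 + \<delta>\<close> towards the other, the angles at \<open>v\<close> are
  \<open>2\<pi>/3 - \<delta>\<close>, \<open>2\<pi>/3 + \<delta>\<close> and \<open>2\<pi>/3\<close>.
\<close>

lemma binary_approx_trees:
  assumes "k \<ge> 1" and "0 \<le> \<delta>" and "\<delta> \<le> pi / 3"
    and edge: "\<And>v. v \<in> {1..<2 * 2 ^ k} \<Longrightarrow> \<exists>l>0. x v - x (v div 2) = of_real l * W v"
    and unit: "\<And>v. norm (W v) = 1"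
    and left: "\<And>v. 1 \<le> v \<Longrightarrow> W (2 * v) = W v * cis (pi / 3 + \<delta>)"
    and right: "\<And>v. 1 \<le> v \<Longrightarrow> W (2 * v + 1) = W v * cis (- pi / 3 + \<delta>)"
  shows "(binary_topology k, x) \<in> approx_trees \<delta> (2 ^ k + 1)"
proof -
  let ?E = "edges (binary_topology k)"
  let ?A = "{2 * pi / 3 - \<delta>..2 * pi / 3 + \<delta>}"
  have at_point: "(\<forall>u. {s, u} \<in> ?E \<longrightarrow> x u \<noteq> x s) \<and>
        (\<forall>u v. {s, u} \<in> ?E \<and> {s, v} \<in> ?E \<and> u \<noteq> v \<longrightarrow> angle (x u - x s) (x v - x s) \<in> ?A)"
    if s: "s \<in> {1..<2 ^ k}" for s
  proof -
    obtain l where l: "l > 0" "x s - x (s div 2) = of_real l * W s"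
      using edge[of s] s by auto
    obtain m where m: "m > 0" "x (2 * s) - x s = of_real m * W (2 * s)"
      using edge[of "2 * s"] s by auto
    obtain r where r: "r > 0" "x (2 * s + 1) - x s = of_real r * W (2 * s + 1)"
      using edge[of "2 * s + 1"] s by auto
    \<comment> \<open>the direction towards the parent is written in two ways, so that each difference of arguments
      below lies in \<open>[0, \<pi>]\<close>\<close>
    have up: "x (s div 2) - x s = of_real l * (W s * cis pi)"
        "x (s div 2) - x s = of_real l * (W s * cis (- pi))"
      using l(2) by (simp_all add: algebra_simps flip: cis_cnj)
    have lft: "x (2 * s) - x s = of_real m * (W s * cis (pi / 3 + \<delta>))"
      using m left[of s] s by simp
    have rgt: "x (2 * s + 1) - x s = of_real r * (W s * cis (- pi / 3 + \<delta>))"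
      using r right[of s] s by simp
    have "angle (x (2 * s) - x s) (x (s div 2) - x s) = pi - (pi / 3 + \<delta>)"
      unfolding up(1) lft using assms(2,3) l m by (intro angle_cis unit) auto
    moreover have "angle (x (s div 2) - x s) (x (2 * s + 1) - x s) = (- pi / 3 + \<delta>) - (- pi)"
      unfolding up(2) rgt using assms(2,3) l r by (intro angle_cis unit) auto
    moreover have "angle (x (2 * s + 1) - x s) (x (2 * s) - x s) = (pi / 3 + \<delta>) - (- pi / 3 + \<delta>)"
      unfolding lft rgt using assms(2,3) m r by (intro angle_cis unit) auto
    ultimately have ang: "angle (x (2 * s) - x s) (x (s div 2) - x s) \<in> ?A"
        "angle (x (s div 2) - x s) (x (2 * s + 1) - x s) \<in> ?A"
        "angle (x (2 * s + 1) - x s) (x (2 * s) - x s) \<in> ?A"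
      using assms(2) by auto
    have nz: "x (s div 2) \<noteq> x s" "x (2 * s) \<noteq> x s" "x (2 * s + 1) \<noteq> x s"
      using l m r unit[of s] unit[of "2 * s"] unit[of "2 * s + 1"] by auto
    have nb: "u = s div 2 \<or> u = 2 * s \<or> u = 2 * s + 1" if "{s, u} \<in> ?E" for u
      using that unfolding binary_edge_iff by auto
    show ?thesis
      using nb nz ang ang[unfolded angle_commute[of _ "x (s div 2) - x s"]] angle_commute by metis
  qed
  show ?thesis
    unfolding approx_trees_def
    using binary_full_topology[OF assms(1)] at_point
    by (auto simp only: mem_Collect_eq prod.case binary_steiner_points)
qed


section \<open>The two trees\<close>

text \<open>
  The direction in the straight tree of the edge from the parent of \<open>v\<close> to \<open>v\<close>; the value at \<open>0\<close>,
  which has no parent, is irrelevant.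
\<close>

fun branch_dir :: "nat \<Rightarrow> complex" where
  "branch_dir v =
     (if v \<le> 1 then 1 else branch_dir (v div 2) * cis (if even v then pi / 3 else - pi / 3))"

declare branch_dir.simps [simp del]

lemma branch_dir_1 [simp]: "branch_dir 1 = 1" "branch_dir (Suc 0) = 1"
  by (simp_all add: branch_dir.simps)

lemma branch_dir_child:
  assumes "1 \<le> v"
  shows "branch_dir (2 * v) = branch_dir v * cis (pi / 3)"
    and "branch_dir (2 * v + 1) = branch_dir v * cis (- pi / 3)"
  using assms by (simp_all add: branch_dir.simps[of "2 * v"] branch_dir.simps[of "Suc (2 * v)"])

lemma norm_branch_dir [simp]: "norm (branch_dir v) = 1"
  by (induction v rule: branch_dir.induct) (subst branch_dir.simps, simp add: norm_mult)

lemma branch_dir_balanced: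
  assumes "1 \<le> v"
  shows "branch_dir (2 * v) + branch_dir (2 * v + 1) = branch_dir v"
proof -
  have "cis (pi / 3) + cis (- pi / 3) = 1"
    by (simp add: complex_eq_iff cos_60)
  then show ?thesis
    unfolding branch_dir_child[OF assms] by (simp flip: distrib_left)
qed

text \<open>
  The angle \<open>\<phi>\<^sub>j\<close> by which edges of level \<open>j\<close> of the tilted tree are turned against those of the
  straight tree. Here and below, \<open>x\<close> stands for \<open>\<epsilon>/2\<close>.
\<close>

definition tilt :: "nat \<Rightarrow> real \<Rightarrow> nat \<Rightarrow> real" where
  "tilt k x j = (2 * real j - real k) * x"

text \<open>
  The solution \<open>\<sigma>\<^sub>j\<close> of \<open>\<sigma>\<^sub>0 = 0\<close> and \<open>\<sigma>\<^sub>j - \<sigma>\<^sub>j\<^sub>+\<^sub>1 = sin \<phi>\<^sub>j\<close>, in closed form; it also vanishes at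
  \<open>k + 1\<close>.
\<close>

definition shift :: "nat \<Rightarrow> real \<Rightarrow> nat \<Rightarrow> real" where
  "shift k x j = sin (real j * x) * sin (real (Suc k) * x - real j * x) / sin x"

text \<open>
  The position of the vertex \<open>v\<close> in the tilted tree, with the root terminal at the origin.
\<close>

fun tilted_tree :: "nat \<Rightarrow> real \<Rightarrow> nat \<Rightarrow> complex" where
  "tilted_tree k x v = (if v = 0 then 0 else tilted_tree k x (v div 2) +
     of_real ((1 / 2) ^ floor_log v) * (branch_dir v * cis (tilt k x (floor_log v))))"

declare tilted_tree.simps [simp del]

text \<open>
  The position of the vertex \<open>v\<close> in the straight tree: the end of an edge of level \<open>j\<close> is moved
  by \<open>2\<^sup>-\<^sup>j \<sigma>\<^sub>j\<^sub>+\<^sub>1\<close> at right angles to \<open>branch_dir v\<close>. That all edges then do have the directions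
  \<open>branch_dir\<close> is the content of \<open>straight_tree_edge\<close>.
\<close>

definition straight_tree :: "nat \<Rightarrow> real \<Rightarrow> nat \<Rightarrow> complex" where
  "straight_tree k x v = tilted_tree k x v +
     (if v = 0 then 0 else
        of_real ((1 / 2) ^ floor_log v * shift k x (Suc (floor_log v))) * (\<i> * branch_dir v))"

lemma shift_0 [simp]: "shift k x 0 = 0" and shift_Suc [simp]: "shift k x (Suc k) = 0"
  by (simp_all add: shift_def)

lemma shift_diff:
  assumes "sin x \<noteq> 0"
  shows "shift k x j - shift k x (Suc j) = sin (tilt k x j)"
proof -
  have prod: "2 * (sin (real j * x) * sin (real (Suc k) * x - real j * x)) =
      cos (real j * x - (real (Suc k) * x - real j * x)) - cos (real (Suc k) * x)" for j
    by (subst sin_times_sin) simp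
  have "2 * (sin x * sin (tilt k x j)) = cos (x - tilt k x j) - cos (x + tilt k x j)"
    by (subst sin_times_sin) simp
  also have "\<dots> = 2 * (sin (real j * x) * sin (real (Suc k) * x - real j * x))
      - 2 * (sin (real (Suc j) * x) * sin (real (Suc k) * x - real (Suc j) * x))"
    unfolding prod by (simp add: tilt_def algebra_simps cos_diff cos_add)
  finally show ?thesis
    using assms by (simp add: shift_def field_simps)
qed

lemma abs_sin_nat_mult_le: "\<bar>sin (real m * x)\<bar> \<le> real m * \<bar>sin x\<bar>"
proof (induction m)
  case (Suc m)
  have "\<bar>sin (real (Suc m) * x)\<bar> = \<bar>sin (real m * x) * cos x + cos (real m * x) * sin x\<bar>"
    using sin_add[of "real m * x" x] by (simp add: algebra_simps)
  also have "\<dots> \<le> \<bar>sin (real m * x)\<bar> * 1 + 1 * \<bar>sin x\<bar>"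
    by (intro order_trans[OF abs_triangle_ineq] add_mono) (simp_all add: abs_mult mult_left_le mult_left_le_one_le)
  finally show ?case
    using Suc by (simp add: algebra_simps)
qed simp

text \<open>
  Bounding one sine by \<open>j sin x\<close> and the other by its argument gives \<open>j (k + 1 - j) x\<close>, and the
  product of the two integers is at most a quarter of the square of their sum.
\<close>

lemma abs_shift_le:
  assumes "j \<le> Suc k" and "0 \<le> x" and "0 < sin x"
  shows "\<bar>shift k x j\<bar> \<le> (real (Suc k))\<^sup>2 * x / 4"
proof -
  have "\<bar>sin (real (Suc k) * x - real j * x)\<bar> \<le> real (Suc k - j) * x"
  proof -
    have "real (Suc k) * x - real j * x = real (Suc k - j) * x"
      using assms(1) by (simp only: of_nat_diff left_diff_distrib)
    then show ?thesis
      using abs_sin_x_le_abs_x[of "real (Suc k - j) * x"] assms(2) by (simp add: abs_mult)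
  qed
  then have "\<bar>sin (real j * x)\<bar> * \<bar>sin (real (Suc k) * x - real j * x)\<bar> \<le>
      (real j * sin x) * (real (Suc k - j) * x)"
    using abs_sin_nat_mult_le[of j x] assms(3) by (intro mult_mono) auto
  then have "\<bar>shift k x j\<bar> \<le> (real j * real (Suc k - j)) * x"
    using assms(3) by (simp add: shift_def abs_mult divide_le_eq algebra_simps)
  also have "real j * real (Suc k - j) \<le> (real (Suc k))\<^sup>2 / 4"
  proof -
    have "(real j + real (Suc k - j))\<^sup>2 - 4 * (real j * real (Suc k - j)) = (real j - real (Suc k - j))\<^sup>2"
      by (simp add: power2_eq_square algebra_simps)
    moreover have "real j + real (Suc k - j) = real (Suc k)"
      using assms(1) by (simp only: of_nat_diff)
    ultimately have "0 \<le> (real (Suc k))\<^sup>2 - 4 * (real j * real (Suc k - j))"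
      by (metis zero_le_power2)
    then show ?thesis
      by linarith
  qed
  finally show ?thesis
    using assms(2) by (simp add: mult_right_mono)
qed

lemma tilted_tree_edge:
  assumes "1 \<le> v"
  shows "tilted_tree k x v - tilted_tree k x (v div 2) =
    of_real ((1 / 2) ^ floor_log v) * (branch_dir v * cis (tilt k x (floor_log v)))"
  using assms by (subst tilted_tree.simps) simp

text \<open>
  The lengths of siblings differ, since moving their common parent by \<open>2\<^sup>-\<^sup>j 2\<sigma>\<^sub>j\<close> at right angles to
  the edge above it shortens one of them and lengthens the other. At \<open>v = 1\<close> the sign is irrelevant,
  since \<open>\<sigma>\<^sub>0 = 0\<close>.
\<close>

lemma straight_tree_edge:
  assumes "1 \<le> v" and "sin x \<noteq> 0"
  shows "straight_tree k x v - straight_tree k x (v div 2) =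
    of_real ((1 / 2) ^ floor_log v * (cos (tilt k x (floor_log v)) +
      (if even v then - 1 else 1) * (sqrt 3 * shift k x (floor_log v)))) * branch_dir v"
proof (cases "v = 1")
  case True
  have "shift k x (Suc 0) = - sin (tilt k x 0)"
    using shift_diff[OF assms(2), of k 0] by simp
  then show ?thesis
    using True tilted_tree_edge[of 1 k x]
    by (simp add: straight_tree_def tilted_tree.simps[of k x 0] complex_eq_iff)
next
  case False
  define j where "j = floor_log v"
  define \<omega> where "\<omega> = cis (if even v then pi / 3 else - pi / 3)"
  have "2 \<le> v"
    using False assms(1) by simp
  then have j: "floor_log (v div 2) = j - 1" "1 \<le> j"
    using floor_log_rec[of v] by (simp_all add: j_def del: floor_log_half)
  have dir: "branch_dir v = branch_dir (v div 2) * \<omega>"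
    using \<open>2 \<le> v\<close> by (subst branch_dir.simps) (simp add: \<omega>_def)
  have "branch_dir v * cnj \<omega> = branch_dir (v div 2)"
    by (simp add: dir \<omega>_def cis_cnj cis_mult)
  moreover have "cnj \<omega> = Complex (1 / 2) ((if even v then - 1 else 1) * (sqrt 3 / 2))"
    by (simp add: \<omega>_def complex_eq_iff cos_60 sin_60)
  ultimately have parent: "branch_dir (v div 2) =
      branch_dir v * Complex (1 / 2) ((if even v then - 1 else 1) * (sqrt 3 / 2))"
    by simp
  have half: "(1 / 2 :: complex) ^ (j - Suc 0) = 2 * (1 / 2) ^ j"
    using j(2) by (cases j) auto
  have "straight_tree k x v - straight_tree k x (v div 2) =
      of_real ((1 / 2) ^ j) * branch_dir v * (cis (tilt k x j) + \<i> * of_real (shift k x (Suc j))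
        - 2 * of_real (shift k x j) * \<i> * Complex (1 / 2) ((if even v then - 1 else 1) * (sqrt 3 / 2)))"
    using tilted_tree_edge[OF assms(1), of k x] \<open>2 \<le> v\<close> j(2)
    by (simp add: straight_tree_def j(1) half parent j_def[symmetric] algebra_simps del: floor_log_half)
  also have "cis (tilt k x j) + \<i> * of_real (shift k x (Suc j))
        - 2 * of_real (shift k x j) * \<i> * Complex (1 / 2) ((if even v then - 1 else 1) * (sqrt 3 / 2))
      = of_real (cos (tilt k x j) + (if even v then - 1 else 1) * (sqrt 3 * shift k x j))"
    using shift_diff[OF assms(2), of k j] by (simp add: complex_eq_iff)
  finally show ?thesis
    by (simp add: j_def mult_ac)
qed

lemma straight_tree_terminal:
  assumes "v \<in> insert 0 {2 ^ k..<2 * 2 ^ k}"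
  shows "straight_tree k x v = tilted_tree k x v"
proof (cases "v = 0")
  case False
  then have "floor_log v = k"
    using assms by (intro floor_log_eqI) auto
  then show ?thesis
    by (simp add: straight_tree_def)
qed (simp add: straight_tree_def)

text \<open>
  There are \<open>2 ^ j\<close> edges of level \<open>j\<close>, so each level has total weight \<open>1\<close>.
\<close>

lemma sum_levels:
  "(\<Sum>v = 1..<2 * 2 ^ k. (1 / 2) ^ floor_log v * f (floor_log v)) = (\<Sum>j\<le>k. f j :: real)"
proof -
  let ?g = "\<lambda>v. (1 / 2) ^ floor_log v * f (floor_log v)"
  have level: "(\<Sum>v = 2 ^ j..<2 * 2 ^ j. ?g v) = f j" for j
  proof -
    have "(\<Sum>v = 2 ^ j..<2 * 2 ^ j. ?g v) = (\<Sum>v = 2 ^ j..<2 * (2 ^ j :: nat). (1 / 2) ^ j * f j)"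
    proof (intro sum.cong refl)
      fix v :: nat
      assume v: "v \<in> {2 ^ j..<2 * 2 ^ j}"
      then have "v > 0"
        by (metis atLeastLessThan_iff gr0I le_zero_eq power_not_zero zero_neq_numeral)
      then have "floor_log v = j"
        using v by (intro floor_log_eqI) auto
      then show "?g v = (1 / 2) ^ j * f j"
        by simp
    qed
    also have "\<dots> = f j"
      by (simp add: power_one_over)
    finally show ?thesis .
  qed
  show ?thesis
  proof (induction k)
    case 0
    show ?case
      using level[of 0] by simp
  next
    case (Suc k)
    have "(\<Sum>v = 1..<2 * 2 ^ Suc k. ?g v) =
        (\<Sum>v = 1..<2 * 2 ^ k. ?g v) + (\<Sum>v = 2 ^ Suc k..<2 * 2 ^ Suc k. ?g v)"
      by (subst sum.atLeastLessThan_concat[symmetric, where n = "2 * 2 ^ k"]) auto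
    then show ?case
      unfolding Suc.IH level by simp
  qed
qed

lemma sum_cos_tilt:
  "sin x * (\<Sum>j\<le>k. cos (tilt k x j)) = sin (real (Suc k) * x)"
proof -
  have "2 * sin x * (\<Sum>j<m. cos (tilt k x j)) =
      sin ((2 * real m - 1 - real k) * x) + sin (real (Suc k) * x)" for m
  proof (induction m)
    case 0
    have "(- 1 - real k) * x = - (real (Suc k) * x)"
      by (simp add: algebra_simps)
    then show ?case
      using sin_minus[of "real (Suc k) * x"] by simp
  next
    case (Suc m)
    \<comment> \<open>the sum telescopes\<close>
    have "2 * sin x * cos (tilt k x m) = sin (tilt k x m + x) - sin (tilt k x m - x)"
      by (simp add: sin_add sin_diff)
    moreover have "tilt k x m + x = (2 * real (Suc m) - 1 - real k) * x"
        "tilt k x m - x = (2 * real m - 1 - real k) * x"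
      by (simp_all add: tilt_def algebra_simps)
    ultimately show ?case
      using Suc by (simp add: distrib_left)
  qed
  moreover have "2 * real (Suc k) - 1 - real k = real (Suc k)"
    by simp
  ultimately have "2 * (sin x * (\<Sum>j\<le>k. cos (tilt k x j))) = 2 * sin (real (Suc k) * x)"
    by (metis lessThan_Suc_atMost mult.assoc mult_2)
  then show ?thesis
    by simp
qed

section \<open>Estimates for the lengths\<close>

lemma sin_upper_bound:
  assumes "0 \<le> (x::real)"
  shows "sin x \<le> x - x ^ 3 / 6 + x ^ 5 / 120"
proof -
  have "(\<Sum>m<5. sin_coeff m * x ^ m) = x - x ^ 3 / 6"
    by (simp add: sin_coeff_def lessThan_nat_numeral fact_numeral)
  then have "\<bar>sin x - (x - x ^ 3 / 6)\<bar> \<le> x ^ 5 / 120"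
    using Maclaurin_sin_bound[of x 5] assms by (simp add: fact_numeral)
  then show ?thesis
    by linarith
qed

lemma sin_lower_bound:
  assumes "0 \<le> (x::real)"
  shows "x - x ^ 3 / 6 \<le> sin x"
proof -
  have "(\<Sum>m<3. sin_coeff m * x ^ m) = x"
    by (simp add: sin_coeff_def lessThan_nat_numeral)
  then have "\<bar>sin x - (x)\<bar> \<le> x ^ 3 / 6"
    using Maclaurin_sin_bound[of x 3] assms by (simp add: fact_numeral)
  then show ?thesis
    by linarith
qed

text \<open>
  With \<open>m = k + 1\<close>, Taylor expansion makes the left-hand side divided by \<open>m x\<close> approximately
  \<open>1 - m\<^sup>2 x\<^sup>2/6\<close>, and the right-hand side \<open>1 - (k\<^sup>2 + 1) x\<^sup>2/6\<close>. The difference, about \<open>k x\<^sup>2/3\<close>, has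
  to absorb the quintic term of the left-hand side, which the bound on \<open>x\<close> makes at most \<open>x\<^sup>2/30\<close>.
\<close>

lemma sin_ratio_bound:
  assumes "k \<ge> 1" and "0 < x" and "2 * (real k)\<^sup>2 * x \<le> 1"
  shows "sin (real (Suc k) * x) < real (Suc k) * (1 - (real k * x)\<^sup>2 / 6) * sin x"
proof -
  define m where "m = real (Suc k)"
  have m: "2 \<le> m" "m \<le> 2 * real k" "real k = m - 1"
    using assms(1) by (simp_all add: m_def)
  have "m\<^sup>2 \<le> (2 * real k)\<^sup>2"
    using m by (intro power_mono) auto
  then have "m\<^sup>2 * x \<le> 4 * (real k)\<^sup>2 * x"
    using assms(2) by (intro mult_right_mono) (auto simp: power_mult_distrib)
  then have mx: "m\<^sup>2 * x \<le> 2"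
    using assms(3) by linarith
  have "(m\<^sup>2 * x)\<^sup>2 \<le> 2\<^sup>2"
    using mx assms(2) by (intro power_mono) auto
  then have quart: "m ^ 4 * x\<^sup>2 \<le> 4"
    by (simp add: power_mult_distrib)
  have kx: "(real k * x)\<^sup>2 \<le> 1"
  proof -
    have "real k * x * 1 \<le> real k * x * real k"
      using assms by (intro mult_left_mono) auto
    moreover have "2 * (real k * x * real k) \<le> 1"
      using assms(3) by (simp add: power2_eq_square mult_ac)
    moreover have "0 \<le> real k * x"
      using assms(2) by simp
    ultimately have "real k * x \<le> 1"
      by linarith
    then show ?thesis
      using assms(2) by (intro power_le_one) auto
  qed
  have "sin (m * x) \<le> m * x - (m * x) ^ 3 / 6 + (m * x) ^ 5 / 120"
    using assms(2) m by (intro sin_upper_bound) auto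
  also have "\<dots> = m * (1 - m\<^sup>2 * x\<^sup>2 / 6 + m ^ 4 * x\<^sup>2 * x\<^sup>2 / 120) * x"
    by (simp add: eval_nat_numeral algebra_simps)
  also have "\<dots> \<le> m * (1 - m\<^sup>2 * x\<^sup>2 / 6 + 4 * x\<^sup>2 / 120) * x"
    using quart m assms(2) by (intro mult_right_mono mult_left_mono add_left_mono divide_right_mono) auto
  also have "\<dots> < m * (1 - (real k)\<^sup>2 * x\<^sup>2 / 6 - x\<^sup>2 / 6) * x"
  proof -
    have "0 < (2 * m - 2 - 1 / 5) * x\<^sup>2 / 6"
      using m assms(2) by simp
    also have "\<dots> = (1 - (real k)\<^sup>2 * x\<^sup>2 / 6 - x\<^sup>2 / 6) - (1 - m\<^sup>2 * x\<^sup>2 / 6 + 4 * x\<^sup>2 / 120)"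
      unfolding m(3) by (simp add: power2_diff field_simps)
    finally have "1 - m\<^sup>2 * x\<^sup>2 / 6 + 4 * x\<^sup>2 / 120 < 1 - (real k)\<^sup>2 * x\<^sup>2 / 6 - x\<^sup>2 / 6"
      by linarith
    then show ?thesis
      using m assms(2) by (intro mult_strict_right_mono mult_strict_left_mono) auto
  qed
  also have "\<dots> \<le> m * ((1 - (real k * x)\<^sup>2 / 6) * (1 - x\<^sup>2 / 6)) * x"
    using m assms(2) by (intro mult_right_mono mult_left_mono) (auto simp: algebra_simps)
  also have "\<dots> = m * (1 - (real k * x)\<^sup>2 / 6) * (x - x ^ 3 / 6)"
    by (simp add: eval_nat_numeral algebra_simps)
  also have "\<dots> \<le> m * (1 - (real k * x)\<^sup>2 / 6) * sin x"
    using m assms(2) kx sin_lower_bound[of x] by (intro mult_left_mono mult_nonneg_nonneg) auto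
  finally show ?thesis
    by (simp only: m_def)
qed

section \<open>The lower bound\<close>

theorem theorem4p4:
  fixes k :: nat and c \<epsilon> :: real
  assumes "k \<ge> 1" and "0 < c" and "c < 1" and "\<epsilon> = c / (real k)\<^sup>2"
  shows "steiner_gap TYPE(real ^ 2) \<epsilon> (2 ^ k + 1) > ereal (c / 24 * \<epsilon>)"
proof -
  define x where "x = \<epsilon> / 2"
  let ?n = "2 ^ k + 1" and ?\<T> = "binary_topology k"
  let ?T = "(?\<T>, tilted_tree k x)" and ?S = "(?\<T>, straight_tree k x)"
  have k2: "(real k)\<^sup>2 * x = c / 2" "1 \<le> (real k)\<^sup>2"
    using assms by (simp_all add: x_def)
  have "0 < \<epsilon>"
    using assms by simp
  then have x0: "0 < x"
    by (simp add: x_def)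
  have "1 * x \<le> (real k)\<^sup>2 * x"
    using k2 x0 by (intro mult_right_mono) auto
  then have "x < 1 / 2"
    using k2 assms by linarith
  then have x_pi: "\<epsilon> \<le> pi / 3" "x < pi"
    using pi_gt3 by (simp_all add: x_def)
  then have sin_pos: "0 < sin x"
    using x0 by (intro sin_gt_zero) auto
  have "real k * x \<le> (real k)\<^sup>2 * x"
    using assms(1) x0 by (simp add: power2_eq_square)
  then have kx: "real k * x < 1 / 2"
    using k2 assms by linarith
  \<comment> \<open>the edges of the straight tree have positive length: \<open>\<bar>\<sigma>\<^sub>j\<bar> \<le> 1/2\<close>, and \<open>\<surd>3/2 < 7/8 \<le> cos \<phi>\<^sub>j\<close>\<close>
  have positive: "sqrt 3 * \<bar>shift k x j\<bar> < cos (tilt k x j)" if "j \<le> k" for j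
  proof -
    have "(real (Suc k))\<^sup>2 \<le> (2 * real k)\<^sup>2"
      using assms(1) by (intro power_mono) auto
    then have "(real (Suc k))\<^sup>2 * x \<le> 4 * ((real k)\<^sup>2 * x)"
      using x0 by (simp add: power_mult_distrib)
    then have "\<bar>shift k x j\<bar> \<le> 1 / 2"
      using abs_shift_le[of j k x] that x0 sin_pos k2 assms(3) by simp
    moreover have "sqrt 3 < 7 / 4"
      by (rule real_less_lsqrt) (auto simp: power2_eq_square)
    moreover from calculation(1) have "sqrt 3 * \<bar>shift k x j\<bar> \<le> sqrt 3 * (1 / 2)"
      by (intro mult_left_mono) auto
    ultimately have "sqrt 3 * \<bar>shift k x j\<bar> < 7 / 8"
      by linarith
    moreover have "7 / 8 \<le> cos (tilt k x j)"
    proof -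
      have "\<bar>2 * real j - real k\<bar> \<le> real k"
        using that by auto
      then have "\<bar>tilt k x j\<bar> \<le> real k * x"
        using x0 by (simp add: tilt_def abs_mult)
      then have "\<bar>tilt k x j / 2\<bar> \<le> 1 / 4"
        using kx by simp
      then have "\<bar>sin (tilt k x j / 2)\<bar> \<le> 1 / 4"
        using abs_sin_x_le_abs_x[of "tilt k x j / 2"] by linarith
      then have "(sin (tilt k x j / 2))\<^sup>2 \<le> (1 / 4)\<^sup>2"
        by (metis abs_ge_zero power2_abs power_mono)
      moreover have "cos (tilt k x j) = 1 - 2 * (sin (tilt k x j / 2))\<^sup>2"
        using cos_double_sin[of "tilt k x j / 2"] by simp
      ultimately show ?thesis
        by (simp add: power2_eq_square)
    qed
    ultimately show ?thesis
      by linarith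
  qed
  have S_edge: "\<exists>l>0. straight_tree k x v - straight_tree k x (v div 2) = of_real l * branch_dir v"
    if v: "v \<in> {1..<2 * 2 ^ k}" for v
  proof -
    have "2 ^ floor_log v \<le> v"
      using v by (intro floor_log_exp2_le) auto
    then have "(2::nat) ^ floor_log v < 2 ^ Suc k"
      using v by simp
    then have "floor_log v \<le> k"
      by (simp only: power_strict_increasing_iff[of "2::nat"] less_Suc_eq_le)
    from positive[OF this] have "\<bar>sqrt 3 * shift k x (floor_log v)\<bar> < cos (tilt k x (floor_log v))"
      by (simp add: abs_mult)
    then have "0 < cos (tilt k x (floor_log v)) + (if even v then - 1 else 1) * (sqrt 3 * shift k x (floor_log v))"
      by (cases "even v") (simp_all add: abs_less_iff)
    then show ?thesis
      using straight_tree_edge[of v x k] v sin_pos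
      by (intro exI[of _ "(1 / 2) ^ floor_log v * (cos (tilt k x (floor_log v)) +
        (if even v then - 1 else 1) * (sqrt 3 * shift k x (floor_log v)))"]) auto
  qed
  have S_approx: "?S \<in> approx_trees 0 ?n"
    using assms(1) S_edge branch_dir_child by (intro binary_approx_trees[of k 0 _ branch_dir]) auto
  have tilt_Suc: "tilt k x (Suc j) = tilt k x j + \<epsilon>" for j
    by (simp add: tilt_def x_def algebra_simps)
  have T_approx: "?T \<in> approx_trees \<epsilon> ?n"
  proof (rule binary_approx_trees[where W = "\<lambda>v. branch_dir v * cis (tilt k x (floor_log v))"])
    show "\<exists>l>0. tilted_tree k x v - tilted_tree k x (v div 2) =
        of_real l * (branch_dir v * cis (tilt k x (floor_log v)))" if "v \<in> {1..<2 * 2 ^ k}" for v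
      using tilted_tree_edge[of v k x] that by (intro exI[of _ "(1 / 2) ^ floor_log v"]) auto
    show "branch_dir (2 * v) * cis (tilt k x (floor_log (2 * v))) =
        branch_dir v * cis (tilt k x (floor_log v)) * cis (pi / 3 + \<epsilon>)" if "1 \<le> v" for v
      using that unfolding branch_dir_child[OF that]
      by (simp add: tilt_Suc mult.assoc cis_mult add_ac)
    show "branch_dir (2 * v + 1) * cis (tilt k x (floor_log (2 * v + 1))) =
        branch_dir v * cis (tilt k x (floor_log v)) * cis (- pi / 3 + \<epsilon>)" if "1 \<le> v" for v
      using that unfolding branch_dir_child[OF that]
      by (simp add: tilt_Suc mult.assoc cis_mult algebra_simps floor_log_rec)
  qed (use assms(1) \<open>0 < \<epsilon>\<close> x_pi in \<open>simp_all add: norm_mult\<close>)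
  have calibrated: "\<exists>l\<ge>0. straight_tree k x v - straight_tree k x (v div 2) = l *\<^sub>R branch_dir v"
    if "v \<in> {1..<2 * 2 ^ k}" for v
    using S_edge[OF that] by (metis less_imp_le scaleR_conv_of_real)
  note calibration = binary_calibration[of branch_dir k "straight_tree k x" "tilted_tree k x",
      OF branch_dir_balanced norm_branch_dir calibrated straight_tree_terminal]
  have S_shortest: "is_shortest ?n ?T ?S"
    by (rule calibration(2))
  have len_T: "tree_length ?T = real (Suc k)"
  proof -
    have "tree_length ?T = (\<Sum>v = 1..<2 * 2 ^ k. (1 / 2) ^ floor_log v * 1)"
      unfolding binary_tree_length dist_norm
      by (intro sum.cong) (auto simp: tilted_tree_edge norm_mult norm_power norm_divide)
    then show ?thesis
      using sum_levels[where k = k and f = "\<lambda>_. 1"] by simp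
  qed
  have len_S: "tree_length ?S = (\<Sum>j\<le>k. cos (tilt k x j))"
  proof -
    have "(tilted_tree k x v - tilted_tree k x (v div 2)) \<bullet> branch_dir v =
        (1 / 2) ^ floor_log v * cos (tilt k x (floor_log v))" if "v \<in> {1..<2 * 2 ^ k}" for v
    proof -
      have "(branch_dir v * cis \<theta>) \<bullet> branch_dir v = (norm (branch_dir v))\<^sup>2 * cos \<theta>" for \<theta>
        unfolding cmod_power2 by (simp add: inner_complex_def power2_eq_square algebra_simps)
      then show ?thesis
        using that tilted_tree_edge[of v k x] by (simp flip: scaleR_conv_of_real of_real_power)
    qed
    moreover have "tree_length ?S =
        (\<Sum>v = 1..<2 * 2 ^ k. (tilted_tree k x v - tilted_tree k x (v div 2)) \<bullet> branch_dir v)"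
      by (rule calibration(1))
    ultimately have "tree_length ?S = (\<Sum>v = 1..<2 * 2 ^ k. (1 / 2) ^ floor_log v * cos (tilt k x (floor_log v)))"
      by simp
    then show ?thesis
      by (simp only: sum_levels[where f = "\<lambda>j. cos (tilt k x j)"])
  qed
  define C where "C = (\<Sum>j\<le>k. cos (tilt k x j))"
  have "C > 0"
    unfolding C_def
  proof (rule sum_pos)
    show "0 < cos (tilt k x j)" if "j \<in> {..k}" for j
      using positive[of j] that by (intro le_less_trans[OF _ positive]) auto
  qed auto
  have bound: "C < real (Suc k) * (1 - (real k * x)\<^sup>2 / 6)"
  proof -
    have "2 * (real k)\<^sup>2 * x \<le> 1"
      using k2 assms by simp
    then have "sin x * C < sin x * (real (Suc k) * (1 - (real k * x)\<^sup>2 / 6))"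
      using sin_ratio_bound[OF assms(1) x0] sum_cos_tilt[of x k] by (simp add: C_def mult_ac)
    then show ?thesis
      using sin_pos by simp
  qed
  have gain: "c / 24 * \<epsilon> = (real k * x)\<^sup>2 / 6"
    using k2 assms(1) by (simp add: x_def power2_eq_square field_simps)
  have "C * (1 + (real k * x)\<^sup>2 / 6) < real (Suc k)"
  proof -
    have "C * (1 + (real k * x)\<^sup>2 / 6) <
        real (Suc k) * (1 - (real k * x)\<^sup>2 / 6) * (1 + (real k * x)\<^sup>2 / 6)"
      using bound by (intro mult_strict_right_mono) (auto intro: add_pos_nonneg)
    also have "\<dots> = real (Suc k) * (1 - ((real k * x)\<^sup>2 / 6)\<^sup>2)"
    proof -
      have "m * (1 - g) * (1 + g) = m * (1 - g\<^sup>2)" for m g :: real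
        by (simp add: power2_eq_square algebra_simps)
      then show ?thesis .
    qed
    also have "\<dots> \<le> real (Suc k)"
      by (simp add: mult_left_le)
    finally show ?thesis .
  qed
  then have "c / 24 * \<epsilon> < (tree_length ?T - tree_length ?S) / tree_length ?S"
    unfolding gain len_T len_S C_def[symmetric] using \<open>C > 0\<close>
    by (simp add: less_divide_eq algebra_simps)
  then have "ereal (c / 24 * \<epsilon>) < ereal ((tree_length ?T - tree_length ?S) / tree_length ?S)"
    by simp
  also have "\<dots> \<le> steiner_gap TYPE(complex) \<epsilon> ?n"
    unfolding steiner_gap_def using T_approx S_approx S_shortest by (intro Sup_upper) blast
  also have "\<dots> \<le> steiner_gap TYPE(real ^ 2) \<epsilon> ?n"
    by (rule steiner_gap_complex_le)
  finally show ?thesis .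
qed

end
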